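(* (Soundness) For every formula $\varphi$, if the sequent $\vdash\varphi$ (empty antecedent, succedent $\{\varphi\}$) is derivable in the sequent calculus $\mathrm{SLC}^{\triangleright}$, then $\varphi$ is $\mathrm{LC}^{\triangleright}$-valid.
   Context: Formulae: $\varphi ::= p \mid \top \mid \bot \mid \varphi\land\varphi \mid \varphi\lor\varphi \mid \varphi\to\varphi \mid \varphi\Rightarrow\varphi \mid \triangleright\varphi$ with $p$ a propositional variable. Kripke semantics: an $\mathrm{LC}^{\triangleright}$-frame is $\langle W,R\rangle$, $W$ nonempty, $R$ transitive, converse-well-founded (no infinite $x_1Rx_2R\cdots$) and connected ($x=y$ or $xRy$ or $yRx$); a model adds a persistent valuation $\vartheta$ ($w\in\vartheta(p)$, $wRx$ imply $x\in\vartheta(p)$). With $R^{=}$ the reflexive closure: $M,w\Vdash p$ iff $w\in\vartheta(p)$; $\top,\bot,\land,\lor$ as usual; $M,w\Vdash\varphi\to\psi$ iff for all $x$ with $wR^{=}x$, $M,x\Vdash\varphi$ implies $M,x\Vdash\psi$; $M,w\Vdash\varphi\Rightarrow\psi$ iff the same for all $x$ with $wRx$; $M,w\Vdash\triangleright\varphi$ iff $M,x\Vdash\varphi$ for all $x$ with $wRx$. $\varphi$ is $\mathrm{LC}^{\triangleright}$-valid if forced at every world of every such model. The calculus $\mathrm{SLC}^{\triangleright}$: sequents $\Gamma\vdash\Delta$ with $\Gamma,\Delta$ finite sets of formulae; $\Gamma,\varphi$ means $\Gamma\cup\{\varphi\}$. Axioms: $\Gamma\vdash\top,\Delta$; $\Gamma,\varphi\vdash\varphi,\Delta$;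 $\Gamma,\bot\vdash\Delta$. Rules (premises / conclusion): ($\lor L$) $\Gamma,\varphi\vdash\Delta$ and $\Gamma,\psi\vdash\Delta$ / $\Gamma,\varphi\lor\psi\vdash\Delta$; ($\lor R$) $\Gamma\vdash\varphi,\psi,\Delta$ / $\Gamma\vdash\varphi\lor\psi,\Delta$; ($\land L$) $\Gamma,\varphi,\psi\vdash\Delta$ / $\Gamma,\varphi\land\psi\vdash\Delta$; ($\land R$) $\Gamma\vdash\varphi,\Delta$ and $\Gamma\vdash\psi,\Delta$ / $\Gamma\vdash\varphi\land\psi,\Delta$; ($\to L$) $\Gamma,\varphi\Rightarrow\psi\vdash\varphi,\Delta$ and $\Gamma,\varphi\Rightarrow\psi,\psi\vdash\Delta$ / $\Gamma,\varphi\to\psi\vdash\Delta$; ($\to R$) $\Gamma,\varphi\vdash\psi,\Delta$ and $\Gamma\vdash\varphi\Rightarrow\psi,\Delta$ / $\Gamma\vdash\varphi\to\psi,\Delta$. Step rule: the conclusion is $\Sigma_l,\triangleright\Theta,\Rightarrow\!\Gamma\vdash\Rightarrow\!\Delta,\triangleright\Phi,\Sigma_r$ where $\triangleright\Theta=\{\triangleright\theta:\theta\in\Theta\}$, $\Rightarrow\!\Gamma=\{\alpha_j\Rightarrow\beta_j\}_j$, $\Rightarrow\!\Delta=\{\varphi_1\Rightarrow\psi_1,\dots,\varphi_k\Rightarrow\psi_k\}$, $\triangleright\Phi=\{\triangleright\phi_1,\dots,\triangleright\phi_n\}$; write $\to\!\Gamma=\{\alpha_j\to\beta_j\}_j$,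 $\to\!\Delta=\{\varphi_i\to\psi_i\}_{i\le k}$ and $\to\!\Delta_{-i}=\to\!\Delta\setminus\{\varphi_i\to\psi_i\}$. It has $k+n$ premises: for $1\le i\le k$, $\Sigma_l,\to\!\Gamma,\Theta,\triangleright\Theta,\varphi_i\Rightarrow\psi_i,\varphi_i\vdash\psi_i,\to\!\Delta_{-i},\Phi$; for $1\le i\le n$, $\Sigma_l,\Theta,\triangleright\Theta,\to\!\Gamma,\triangleright\phi_i\vdash\to\!\Delta,\Phi$. Side conditions: $k+n\ge1$; $\bot\notin\Sigma_l$, $\top\notin\Sigma_r$ and the conclusion is not an instance of the axiom $\Gamma,\varphi\vdash\varphi,\Delta$; $\Sigma_l$ and $\Sigma_r$ contain only atomic formulae (propositional variables, $\top$, $\bot$). A derivation is a finite tree of sequents built from these rules whose leaves are axioms. *)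

theory Defs
  imports Main "HOL-Library.FSet"
begin

datatype 'p fm =
    Var 'p
  | Top  ("\<^bold>\<top>")
  | Bot  ("\<^bold>\<bottom>")
  | And "'p fm" "'p fm"  (infixr "\<^bold>\<and>" 75)
  | Or "'p fm" "'p fm"  (infixr "\<^bold>\<or>" 74)
  | Imp "'p fm" "'p fm"  (infixr "\<^bold>\<rightarrow>" 73)
  | SImp "'p fm" "'p fm"  (infixr "\<^bold>\<Rightarrow>" 73)
  | Later "'p fm"  ("\<^bold>\<triangleright> _" [80] 80)

fun atomic_fm :: "'p fm \<Rightarrow> bool" where
  "atomic_fm (Var p) = True"
| "atomic_fm \<^bold>\<top> = True"
| "atomic_fm \<^bold>\<bottom> = True"
| "atomic_fm _ = False"

definition LC_frame :: "'w set \<Rightarrow> ('w \<times> 'w) set \<Rightarrow> bool" where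
  "LC_frame W R \<longleftrightarrow>
     W \<noteq> {} \<and> R \<subseteq> W \<times> W \<and> trans R \<and>
     \<not> (\<exists>f :: nat \<Rightarrow> 'w. \<forall>i. (f i, f (Suc i)) \<in> R) \<and>
     (\<forall>x\<in>W. \<forall>y\<in>W. x = y \<or> (x, y) \<in> R \<or> (y, x) \<in> R)"

definition LC_model :: "'w set \<Rightarrow> ('w \<times> 'w) set \<Rightarrow> ('p \<Rightarrow> 'w set) \<Rightarrow> bool" where
  "LC_model W R V \<longleftrightarrow>
     LC_frame W R \<and> (\<forall>p. V p \<subseteq> W) \<and>
     (\<forall>p w x. w \<in> V p \<longrightarrow> (w, x) \<in> R \<longrightarrow> x \<in> V p)"

text \<open>Since \<open>R \<subseteq> W \<times> W\<close> in a frame, the quantifiers over \<open>R\<close>-successors below stay in \<open>W\<close>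
  whenever the evaluation starts at a world of \<open>W\<close>.\<close>

primrec forces :: "('w \<times> 'w) set \<Rightarrow> ('p \<Rightarrow> 'w set) \<Rightarrow> 'w \<Rightarrow> 'p fm \<Rightarrow> bool" where
  "forces R V w (Var p) \<longleftrightarrow> w \<in> V p"
| "forces R V w \<^bold>\<top> \<longleftrightarrow> True"
| "forces R V w \<^bold>\<bottom> \<longleftrightarrow> False"
| "forces R V w (\<phi> \<^bold>\<and> \<psi>) \<longleftrightarrow> forces R V w \<phi> \<and> forces R V w \<psi>"
| "forces R V w (\<phi> \<^bold>\<or> \<psi>) \<longleftrightarrow> forces R V w \<phi> \<or> forces R V w \<psi>"
| "forces R V w (\<phi> \<^bold>\<rightarrow> \<psi>) \<longleftrightarrow> (\<forall>x. (w, x) \<in> R\<^sup>= \<longrightarrow> forces R V x \<phi> \<longrightarrow> forces R V x \<psi>)"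
| "forces R V w (\<phi> \<^bold>\<Rightarrow> \<psi>) \<longleftrightarrow> (\<forall>x. (w, x) \<in> R \<longrightarrow> forces R V x \<phi> \<longrightarrow> forces R V x \<psi>)"
| "forces R V w (\<^bold>\<triangleright> \<phi>) \<longleftrightarrow> (\<forall>x. (w, x) \<in> R \<longrightarrow> forces R V x \<phi>)"

text \<open>HOL cannot quantify over types inside a formula, so validity carries the type from which the
  worlds are drawn; quantifying over all frames amounts to leaving \<open>'w\<close> free in a theorem.\<close>

definition LC_valid :: "'w itself \<Rightarrow> 'p fm \<Rightarrow> bool" where
  "LC_valid (_ :: 'w itself) \<phi> \<longleftrightarrow>
     (\<forall>(W :: 'w set) R V. LC_model W R V \<longrightarrow> (\<forall>w\<in>W. forces R V w \<phi>))"

definition laters :: "'p fm fset \<Rightarrow> 'p fm fset" where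
  "laters \<Theta> = Later |`| \<Theta>"

text \<open>A set of implications is given by the set of its (antecedent, consequent) pairs.\<close>

definition imps :: "('p fm \<times> 'p fm) fset \<Rightarrow> 'p fm fset" where
  "imps D = (\<lambda>(\<phi>, \<psi>). \<phi> \<^bold>\<rightarrow> \<psi>) |`| D"

definition strict_imps :: "('p fm \<times> 'p fm) fset \<Rightarrow> 'p fm fset" where
  "strict_imps D = (\<lambda>(\<phi>, \<psi>). \<phi> \<^bold>\<Rightarrow> \<psi>) |`| D"

text \<open>In rule \<open>Step\<close>, \<open>G\<close> and \<open>D\<close> are the pairs underlying the strict implications on the left and
  on the right; the set of premises is indexed by the elements of \<open>D\<close> and of \<open>\<Phi>\<close>.\<close>

inductive SLC :: "'p fm fset \<Rightarrow> 'p fm fset \<Rightarrow> bool"  (infix "\<turnstile>" 50) where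
  TopR: "\<Gamma> \<turnstile> finsert \<^bold>\<top> \<Delta>"
| Id: "finsert \<phi> \<Gamma> \<turnstile> finsert \<phi> \<Delta>"
| BotL: "finsert \<^bold>\<bottom> \<Gamma> \<turnstile> \<Delta>"
| OrL: "finsert \<phi> \<Gamma> \<turnstile> \<Delta> \<Longrightarrow> finsert \<psi> \<Gamma> \<turnstile> \<Delta> \<Longrightarrow> finsert (\<phi> \<^bold>\<or> \<psi>) \<Gamma> \<turnstile> \<Delta>"
| OrR: "\<Gamma> \<turnstile> finsert \<phi> (finsert \<psi> \<Delta>) \<Longrightarrow> \<Gamma> \<turnstile> finsert (\<phi> \<^bold>\<or> \<psi>) \<Delta>"
| AndL: "finsert \<phi> (finsert \<psi> \<Gamma>) \<turnstile> \<Delta> \<Longrightarrow> finsert (\<phi> \<^bold>\<and> \<psi>) \<Gamma> \<turnstile> \<Delta>"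
| AndR: "\<Gamma> \<turnstile> finsert \<phi> \<Delta> \<Longrightarrow> \<Gamma> \<turnstile> finsert \<psi> \<Delta> \<Longrightarrow> \<Gamma> \<turnstile> finsert (\<phi> \<^bold>\<and> \<psi>) \<Delta>"
| ImpL: "finsert (\<phi> \<^bold>\<Rightarrow> \<psi>) \<Gamma> \<turnstile> finsert \<phi> \<Delta> \<Longrightarrow>
    finsert (\<phi> \<^bold>\<Rightarrow> \<psi>) (finsert \<psi> \<Gamma>) \<turnstile> \<Delta> \<Longrightarrow>
    finsert (\<phi> \<^bold>\<rightarrow> \<psi>) \<Gamma> \<turnstile> \<Delta>"
| ImpR: "finsert \<phi> \<Gamma> \<turnstile> finsert \<psi> \<Delta> \<Longrightarrow> \<Gamma> \<turnstile> finsert (\<phi> \<^bold>\<Rightarrow> \<psi>) \<Delta> \<Longrightarrow>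
    \<Gamma> \<turnstile> finsert (\<phi> \<^bold>\<rightarrow> \<psi>) \<Delta>"
| Step: "(\<And>\<phi> \<psi>. (\<phi>, \<psi>) |\<in>| D \<Longrightarrow>
      \<Sigma>l |\<union>| imps G |\<union>| \<Theta> |\<union>| laters \<Theta> |\<union>| {|\<phi> \<^bold>\<Rightarrow> \<psi>, \<phi>|}
        \<turnstile> {|\<psi>|} |\<union>| (imps D |-| {|\<phi> \<^bold>\<rightarrow> \<psi>|}) |\<union>| \<Phi>) \<Longrightarrow>
    (\<And>\<phi>. \<phi> |\<in>| \<Phi> \<Longrightarrow>
      \<Sigma>l |\<union>| \<Theta> |\<union>| laters \<Theta> |\<union>| imps G |\<union>| {|\<^bold>\<triangleright> \<phi>|} \<turnstile> imps D |\<union>| \<Phi>) \<Longrightarrow>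
    D \<noteq> {||} \<or> \<Phi> \<noteq> {||} \<Longrightarrow>
    \<^bold>\<bottom> |\<notin>| \<Sigma>l \<Longrightarrow> \<^bold>\<top> |\<notin>| \<Sigma>r \<Longrightarrow>
    (\<Sigma>l |\<union>| laters \<Theta> |\<union>| strict_imps G) |\<inter>| (strict_imps D |\<union>| laters \<Phi> |\<union>| \<Sigma>r) = {||} \<Longrightarrow>
    fBall \<Sigma>l atomic_fm \<Longrightarrow> fBall \<Sigma>r atomic_fm \<Longrightarrow>
    \<Sigma>l |\<union>| laters \<Theta> |\<union>| strict_imps G \<turnstile> strict_imps D |\<union>| laters \<Phi> |\<union>| \<Sigma>r"

end

theory Submission
  imports Defs
begin

text \<open>The only rule whose soundness is not immediate is \<open>Step\<close>. Suppose its conclusion fails at \<open>w\<close>,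
  so each formula of \<open>imps D |\<union>| \<Phi>\<close> is refuted strictly above \<open>w\<close>. Refutation is downward closed and
  the frame is linear, so some \<open>x\<close> above \<open>w\<close> refutes all of them at once, and by converse
  well-foundedness \<open>x\<close> can be taken maximal with this property. Then one of the formulae is forced
  everywhere above \<open>x\<close>, and the premise belonging to that formula fails at \<open>x\<close>.\<close>

text \<open>Sequents are evaluated at the single world \<open>w\<close>, not at all its successors;
  this suits the logical rules, whose premises are used at the world of their conclusion.\<close>

definition sat :: "('w \<times> 'w) set \<Rightarrow> ('p \<Rightarrow> 'w set) \<Rightarrow> 'w \<Rightarrow> 'p fm fset \<Rightarrow> 'p fm fset \<Rightarrow> bool" where
  "sat R V w \<Gamma> \<Delta> \<longleftrightarrow>
     ((\<forall>\<gamma>. \<gamma> |\<in>| \<Gamma> \<longrightarrow> forces R V w \<gamma>) \<longrightarrow> (\<exists>\<delta>. \<delta> |\<in>| \<Delta> \<and> forces R V w \<delta>))"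

lemma sat_finsert_left: "sat R V w (finsert \<phi> \<Gamma>) \<Delta> \<longleftrightarrow> (forces R V w \<phi> \<longrightarrow> sat R V w \<Gamma> \<Delta>)"
  unfolding sat_def finsert_iff by blast

lemma sat_finsert_right: "sat R V w \<Gamma> (finsert \<phi> \<Delta>) \<longleftrightarrow> (\<not> forces R V w \<phi> \<longrightarrow> sat R V w \<Gamma> \<Delta>)"
  unfolding sat_def finsert_iff by blast

text \<open>\<open>R\<^sup>=\<close> splits into \<open>w\<close> itself and the strict successors.
  The rules ImpL and ImpR mirror this split, which makes them local to one world.\<close>

lemma forces_Imp_iff:
  "forces R V w (\<phi> \<^bold>\<rightarrow> \<psi>) \<longleftrightarrow>
     (forces R V w \<phi> \<longrightarrow> forces R V w \<psi>) \<and> forces R V w (\<phi> \<^bold>\<Rightarrow> \<psi>)"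
  by auto

lemma satD:
  assumes "sat R V w \<Gamma> \<Delta>" and "\<And>\<gamma>. \<gamma> |\<in>| \<Gamma> \<Longrightarrow> forces R V w \<gamma>"
  obtains \<delta> where "\<delta> |\<in>| \<Delta>" and "forces R V w \<delta>"
  using assms unfolding sat_def by blast

locale LC =
  fixes W :: "'w set" and R :: "('w \<times> 'w) set" and V :: "'p \<Rightarrow> 'w set"
  assumes model: "LC_model W R V"
begin

lemma R_in_W: "(x, y) \<in> R \<Longrightarrow> x \<in> W \<and> y \<in> W"
  using model by (auto simp: LC_model_def LC_frame_def)

lemma R_trans: "(x, y) \<in> R \<Longrightarrow> (y, z) \<in> R \<Longrightarrow> (x, z) \<in> R"
  using model unfolding LC_model_def LC_frame_def by (blast dest: transD)

lemma R_connected: "x \<in> W \<Longrightarrow> y \<in> W \<Longrightarrow> x = y \<or> (x, y) \<in> R \<or> (y, x) \<in> R"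
  using model by (auto simp: LC_model_def LC_frame_def)

lemma wf_converse: "wf (R\<inverse>)"
  using model by (auto simp: LC_model_def LC_frame_def wf_iff_no_infinite_down_chain)

text \<open>Both implications and \<open>Later\<close> quantify over successors, and by transitivity
  every world reflexively above \<open>x\<close> is strictly above \<open>w\<close>.\<close>

lemma forces_persistent: "forces R V w \<phi> \<Longrightarrow> (w, x) \<in> R \<Longrightarrow> forces R V x \<phi>"
proof (induction \<phi>)
  case (Var p)
  then show ?case using model by (auto simp: LC_model_def)
next
  case (Imp \<phi> \<psi>)
  then show ?case using R_trans[of w x] by auto
next
  case (SImp \<phi> \<psi>)
  then show ?case using R_trans[of w x] by simp
next
  case (Later \<phi>)
  then show ?case using R_trans[of w x] by simp
qed auto

lemma common_refuting_world:
  assumes "finite S" "S \<noteq> {}"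
    and "\<And>\<phi>. \<phi> \<in> S \<Longrightarrow> \<exists>x. (w, x) \<in> R \<and> \<not> forces R V x \<phi>"
  shows "\<exists>x. (w, x) \<in> R \<and> (\<forall>\<phi>\<in>S. \<not> forces R V x \<phi>)"
  using assms
proof (induction S rule: finite_ne_induct)
  case (insert \<phi> S)
  obtain x where x: "(w, x) \<in> R" "\<forall>\<psi>\<in>S. \<not> forces R V x \<psi>"
    using insert.IH[OF insert.prems] by blast
  obtain y where y: "(w, y) \<in> R" "\<not> forces R V y \<phi>"
    using insert.prems by blast
  \<comment> \<open>By persistence, whichever of the two worlds is lower refutes all that the upper
    one refutes.\<close>
  from R_connected[of x y] x(1) y(1) R_in_W
  consider "x = y" | "(x, y) \<in> R" | "(y, x) \<in> R" by blast
  then show ?case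
  proof cases
    case 1
    then show ?thesis using x y by blast
  next
    case 2
    then show ?thesis using x y forces_persistent[of x \<phi> y] by blast
  next
    case 3
    then show ?thesis using x y forces_persistent[of y _ x] by blast
  qed
qed simp

lemma last_common_refuting_world:
  assumes "finite S" "S \<noteq> {}"
    and "\<And>\<phi>. \<phi> \<in> S \<Longrightarrow> \<exists>x. (w, x) \<in> R \<and> \<not> forces R V x \<phi>"
  obtains x \<phi> where "(w, x) \<in> R" "\<forall>\<psi>\<in>S. \<not> forces R V x \<psi>"
    "\<phi> \<in> S" "\<forall>y. (x, y) \<in> R \<longrightarrow> forces R V y \<phi>"
proof -
  let ?Q = "{x. (w, x) \<in> R \<and> (\<forall>\<phi>\<in>S. \<not> forces R V x \<phi>)}"
  obtain x0 where "x0 \<in> ?Q" using common_refuting_world[OF assms] by blast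
  \<comment> \<open>Minimality with respect to \<open>R\<inverse>\<close> is maximality with respect
    to \<open>R\<close>.\<close>
  then obtain x where x: "x \<in> ?Q" and max: "\<And>y. (x, y) \<in> R \<Longrightarrow> y \<notin> ?Q"
    using wfE_min[OF wf_converse, of x0 ?Q] by auto
  \<comment> \<open>Otherwise every formula of \<open>S\<close> is refuted above \<open>x\<close>,
    and \<open>common_refuting_world\<close>, applied at \<open>x\<close> instead of
    \<open>w\<close>, yields a member of \<open>?Q\<close> above \<open>x\<close>.\<close>
  have "\<exists>\<phi>\<in>S. \<forall>y. (x, y) \<in> R \<longrightarrow> forces R V y \<phi>"
  proof (rule ccontr)
    assume "\<not> ?thesis"
    then obtain y where "(x, y) \<in> R" "\<forall>\<phi>\<in>S. \<not> forces R V y \<phi>"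
      using common_refuting_world[OF assms(1,2), of x] by blast
    then show False using max x R_trans by blast
  qed
  then show thesis using that x by blast
qed

lemma sat_Step:
  assumes D: "\<And>x \<phi> \<psi>. x \<in> W \<Longrightarrow> (\<phi>, \<psi>) |\<in>| D \<Longrightarrow>
      sat R V x (\<Sigma>l |\<union>| imps G |\<union>| \<Theta> |\<union>| laters \<Theta> |\<union>| {|\<phi> \<^bold>\<Rightarrow> \<psi>, \<phi>|})
        ({|\<psi>|} |\<union>| (imps D |-| {|\<phi> \<^bold>\<rightarrow> \<psi>|}) |\<union>| \<Phi>)"
    and \<Phi>: "\<And>x \<phi>. x \<in> W \<Longrightarrow> \<phi> |\<in>| \<Phi> \<Longrightarrow>
      sat R V x (\<Sigma>l |\<union>| \<Theta> |\<union>| laters \<Theta> |\<union>| imps G |\<union>| {|\<^bold>\<triangleright> \<phi>|}) (imps D |\<union>| \<Phi>)"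
    and ne: "D \<noteq> {||} \<or> \<Phi> \<noteq> {||}"
  shows "sat R V w (\<Sigma>l |\<union>| laters \<Theta> |\<union>| strict_imps G) (strict_imps D |\<union>| laters \<Phi> |\<union>| \<Sigma>r)"
proof (rule ccontr)
  assume "\<not> ?thesis"
  then have left: "\<And>\<gamma>. \<gamma> |\<in>| \<Sigma>l |\<union>| laters \<Theta> |\<union>| strict_imps G \<Longrightarrow> forces R V w \<gamma>"
    and right: "\<And>\<delta>. \<delta> |\<in>| strict_imps D |\<union>| laters \<Phi> |\<union>| \<Sigma>r \<Longrightarrow> \<not> forces R V w \<delta>"
    unfolding sat_def by blast+
  let ?S = "fset (imps D |\<union>| \<Phi>)"
  have refuted: "\<exists>x. (w, x) \<in> R \<and> \<not> forces R V x \<phi>" if "\<phi> \<in> ?S" for \<phi>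
  proof (cases "\<phi> |\<in>| \<Phi>")
    case True
    then have "\<not> forces R V w (\<^bold>\<triangleright> \<phi>)" by (intro right) (auto simp: laters_def)
    then show ?thesis by auto
  next
    case False
    with that obtain \<alpha> \<beta> where ab: "\<phi> = \<alpha> \<^bold>\<rightarrow> \<beta>" "(\<alpha>, \<beta>) |\<in>| D"
      by (auto simp: imps_def)
    \<comment> \<open>A successor of \<open>w\<close> that forces \<alpha> but not \<beta> refutes
      the plain implication, since \<open>R\<^sup>=\<close> is reflexive.\<close>
    then have "\<not> forces R V w (\<alpha> \<^bold>\<Rightarrow> \<beta>)"
      by (intro right) (force simp: strict_imps_def)
    then show ?thesis using ab by auto
  qed
  have "?S \<noteq> {}" using ne by (auto simp: imps_def)
  then obtain x \<phi> where x: "(w, x) \<in> R" "\<forall>\<psi>\<in>?S. \<not> forces R V x \<psi>"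
    and \<phi>: "\<phi> \<in> ?S" "\<forall>y. (x, y) \<in> R \<longrightarrow> forces R V y \<phi>"
    using last_common_refuting_world[OF _ _ refuted] by (metis finite_fset)
  have xW: "x \<in> W" using x(1) R_in_W by blast
  have "forces R V x \<theta>" if "\<theta> |\<in>| \<Theta>" for \<theta>
    using left[of "\<^bold>\<triangleright> \<theta>"] that x(1) by (auto simp: laters_def)
  moreover have "forces R V x \<gamma>" if "\<gamma> |\<in>| \<Sigma>l |\<union>| laters \<Theta>" for \<gamma>
    using left[of \<gamma>] that x(1) forces_persistent by blast
  \<comment> \<open>Worlds reflexively above \<open>x\<close> are strictly above \<open>w\<close>,
    so a strict implication at \<open>w\<close> becomes a plain one at \<open>x\<close>.\<close>
  moreover have "forces R V x \<gamma>" if \<gamma>: "\<gamma> |\<in>| imps G" for \<gamma>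
  proof -
    obtain \<alpha> \<beta> where ab: "\<gamma> = \<alpha> \<^bold>\<rightarrow> \<beta>" "(\<alpha>, \<beta>) |\<in>| G" using \<gamma> by (auto simp: imps_def)
    then have "forces R V w (\<alpha> \<^bold>\<Rightarrow> \<beta>)"
      by (intro left) (force simp: strict_imps_def)
    then show ?thesis using ab x(1) R_trans[of w x] by auto
  qed
  ultimately have common:
    "forces R V x \<gamma>" if "\<gamma> |\<in>| \<Sigma>l |\<union>| imps G |\<union>| \<Theta> |\<union>| laters \<Theta>" for \<gamma>
    using that by blast
  show False
  proof (cases "\<phi> |\<in>| \<Phi>")
    case True
    have "forces R V x (\<^bold>\<triangleright> \<phi>)" using \<phi>(2) by simp
    with common obtain \<delta> where "\<delta> |\<in>| imps D |\<union>| \<Phi>" "forces R V x \<delta>"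
      using satD[OF \<Phi>[OF xW True]] by blast
    with x(2) show False by blast
  next
    case False
    with \<phi>(1) obtain \<alpha> \<beta> where ab: "\<phi> = \<alpha> \<^bold>\<rightarrow> \<beta>" "(\<alpha>, \<beta>) |\<in>| D"
      by (auto simp: imps_def)
    \<comment> \<open>The plain implication holds at each world strictly above \<open>x\<close>, so
      its failure at \<open>x\<close> can only come from \<open>x\<close> itself, where \<alpha>
      must hold and \<beta> fail.\<close>
    have strict: "forces R V x (\<alpha> \<^bold>\<Rightarrow> \<beta>)" using \<phi>(2) ab(1) by auto
    have "\<not> forces R V x (\<alpha> \<^bold>\<rightarrow> \<beta>)" using x(2) \<phi>(1) ab(1) by blast
    with strict have \<alpha>: "forces R V x \<alpha>" and \<beta>: "\<not> forces R V x \<beta>"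
      unfolding forces_Imp_iff by blast+
    from strict common \<alpha> obtain \<delta>
      where "\<delta> |\<in>| {|\<beta>|} |\<union>| (imps D |-| {|\<alpha> \<^bold>\<rightarrow> \<beta>|}) |\<union>| \<Phi>" "forces R V x \<delta>"
      using satD[OF D[OF xW ab(2)]] by blast
    with x(2) \<beta> show False by blast
  qed
qed

text \<open>The world varies in the induction because the premises of Step are needed at a world
  above that of the conclusion.\<close>

lemma SLC_sound: "\<Gamma> \<turnstile> \<Delta> \<Longrightarrow> w \<in> W \<Longrightarrow> sat R V w \<Gamma> \<Delta>"
proof (induction arbitrary: w rule: SLC.induct)
  case (Step D \<Sigma>l G \<Theta> \<Phi> \<Sigma>r)
  show ?case
  proof (rule sat_Step)
    show "D \<noteq> {||} \<or> \<Phi> \<noteq> {||}" by (rule Step.hyps)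
  qed (rule Step.IH; assumption)+
\<comment> \<open>Every other rule becomes a propositional tautology about truth values at
  \<open>w\<close>.\<close>
qed (simp_all only: sat_finsert_left sat_finsert_right forces_Imp_iff forces.simps(2-5), blast+)

end

theorem theorem2:
  fixes \<phi> :: "'p fm"
  assumes "{||} \<turnstile> {|\<phi>|}"
  shows "LC_valid TYPE('w) \<phi>"
  unfolding LC_valid_def
proof (intro allI impI ballI)
  fix W :: "'w set" and R and V :: "'p \<Rightarrow> 'w set" and w
  assume "LC_model W R V" and w: "w \<in> W"
  then interpret LC W R V by unfold_locales
  have "sat R V w {||} {|\<phi>|}" using assms w by (rule SLC_sound)
  then show "forces R V w \<phi>" by (auto simp: sat_def)
qed

end
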